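(* Let $n\ge1$ be an integer and let $P_n=\operatorname{circ}(0,1,0,\dots,0)$ be the fundamental circulant $n\times n$ matrix. Consider the lattice $\mathbb{Z}v_1+\mathbb{Z}v_2+\dots+\mathbb{Z}v_n$ in the algebra of complex circulant $n\times n$ matrices, generated by the linearly independent vectors $$v_i=c_{i1}I_n+c_{i2}P_n+\dots+c_{in}P_n^{n-1},\qquad 1\le i\le n,$$ and let $C=(c_{ij})$ be the $n\times n$ complex matrix with entries $c_{ij}$. If all the entries of the matrix $C^{-1}$ are integers, then any circulant $n\times n$ matrix with integer entries belongs to this lattice, that is, it may be written as $a_1v_1+a_2v_2+\dots+a_nv_n$ with $a_1,\dots,a_n\in\mathbb{Z}$.
   Context: $\operatorname{circ}(c_1,\dots,c_n)$ denotes the $n\times n$ circulant matrix with $(i,j)$ entry $c_{j-i+1}$ (subscripts mod $n$). *)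

theory Defs
  imports
    "HOL.Complex"
    "Jordan_Normal_Form.VS_Connect"
    "Jordan_Normal_Form.Gauss_Jordan_Elimination"
begin

text \<open>Rows, columns and coefficients are counted from 0: \<open>circ n c\<close> is
  \<open>circ(c 0, \<dots>, c (n - 1))\<close>. The summand \<open>n\<close> keeps the subtraction on \<open>nat\<close>
  from truncating. Only the values \<open>c k\<close> with \<open>k < n\<close> matter.\<close>

definition circ :: "nat \<Rightarrow> (nat \<Rightarrow> 'a) \<Rightarrow> 'a mat" where
  "circ n c = mat n n (\<lambda>(i, j). c ((j + n - i) mod n))"

definition is_circulant :: "nat \<Rightarrow> 'a mat \<Rightarrow> bool" where
  "is_circulant n M \<longleftrightarrow> (\<exists>c. M = circ n c)"

text \<open>The entry 1 sits at position 1, read modulo \<open>n\<close>; hence the matrix is the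
  identity for \<open>n = 1\<close>.\<close>

definition fund_circ :: "nat \<Rightarrow> complex mat" where
  "fund_circ n = circ n (\<lambda>k. if k = 1 mod n then 1 else 0)"

abbreviation cmat_space :: "nat \<Rightarrow> (complex, complex mat) module" where
  "cmat_space n \<equiv> module_mat TYPE(complex) n n"

text \<open>The library notion of linear dependence is about sets of vectors, so injectivity is
  what makes this the linear independence of the family \<open>v 0, \<dots>, v (n - 1)\<close>.\<close>

definition lin_indpt_family :: "nat \<Rightarrow> (nat \<Rightarrow> complex mat) \<Rightarrow> bool" where
  "lin_indpt_family n v \<longleftrightarrow>
     inj_on v {..<n} \<and> \<not> module.lin_dep class_ring (cmat_space n) (v ` {..<n})"

definition int_lattice :: "nat \<Rightarrow> (nat \<Rightarrow> complex mat) \<Rightarrow> complex mat set" where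
  "int_lattice n v =
     range (\<lambda>a :: nat \<Rightarrow> int. \<Oplus>\<^bsub>cmat_space n\<^esub> i \<in> {..<n}. of_int (a i) \<cdot>\<^sub>m v i)"

end

theory Submission
  imports Defs
begin

text \<open>Sending a row \<open>c\<close> of \<open>n\<close> numbers to \<open>circ n c\<close> is linear, and \<open>P\<^sub>n\<^sup>j\<close> is the circulant
  matrix of the \<open>j\<close>-th unit row (\<open>fund_circ_power\<close>). Hence \<open>v i\<close> is the circulant matrix of row
  \<open>i\<close> of \<open>C\<close>, and \<open>\<Sum>i. a i v i\<close> is the circulant matrix of the row \<open>a C\<close>
  (\<open>finsum_smult_circ\<close>). An integer circulant matrix with first row \<open>m\<close> is therefore obtained
  from \<open>a = m C\<^sup>-\<^sup>1\<close>, whose entries are integers when those of \<open>C\<^sup>-\<^sup>1\<close> are.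

  That \<open>C\<close> has an inverse in the first place is what the linear independence of the \<open>v i\<close>
  provides: a nonzero row \<open>w\<close> with \<open>w C = 0\<close> would give the dependence
  \<open>\<Sum>i. w i v i = circ 0 = 0\<close>.\<close>

lemma circ_carrier [simp]: "circ n c \<in> carrier_mat n n"
  by (simp add: circ_def)

lemma circ_cong:
  assumes "\<And>k. k < n \<Longrightarrow> c k = d k"
  shows "circ n c = circ n d"
  unfolding circ_def by (rule eq_matI) (auto intro!: assms)

lemma circ_zero: "circ n (\<lambda>_. 0) = 0\<^sub>m n n"
  by (rule eq_matI) (auto simp: circ_def)

lemma finsum_smult_circ:
  assumes "finite I"
  shows "(\<Oplus>\<^bsub>cmat_space n\<^esub> i \<in> I. a i \<cdot>\<^sub>m circ n (c i)) = circ n (\<lambda>k. \<Sum>i\<in>I. a i * c i k)"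
  using assms
proof (induction I)
  case empty
  interpret abelian_group "cmat_space n" by (rule abelian_group_mat)
  show ?case by (simp add: circ_zero module_mat_simps)
next
  case (insert x I)
  interpret abelian_group "cmat_space n" by (rule abelian_group_mat)
  have "(\<Oplus>\<^bsub>cmat_space n\<^esub> i \<in> insert x I. a i \<cdot>\<^sub>m circ n (c i)) =
      a x \<cdot>\<^sub>m circ n (c x) + (\<Oplus>\<^bsub>cmat_space n\<^esub> i \<in> I. a i \<cdot>\<^sub>m circ n (c i))"
    using insert.hyps by (subst finsum_insert) (auto simp: module_mat_simps)
  also have "\<dots> = a x \<cdot>\<^sub>m circ n (c x) + circ n (\<lambda>k. \<Sum>i\<in>I. a i * c i k)"
    by (simp only: insert.IH)
  also have "\<dots> = circ n (\<lambda>k. \<Sum>i\<in>insert x I. a i * c i k)"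
    using insert.hyps by (intro eq_matI) (auto simp: circ_def)
  finally show ?case .
qed

text \<open>Solves the equation \<open>r - p = j\<close> modulo \<open>n\<close> for \<open>r\<close>, with the difference written as
  in \<open>circ\<close>.\<close>

lemma circ_index_eq_iff:
  fixes p r j n :: nat
  assumes "p < n" "r < n"
  shows "(r + n - p) mod n = j mod n \<longleftrightarrow> r = (p + j) mod n"
proof
  assume "(r + n - p) mod n = j mod n"
  then have "(p + (r + n - p)) mod n = (p + j) mod n"
    by (metis mod_add_right_eq)
  then show "r = (p + j) mod n"
    using assms by simp
next
  assume r: "r = (p + j) mod n"
  have "(r + n - p) mod n = (r + (n - p)) mod n"
    using assms by simp
  also have "\<dots> = (p + j + (n - p)) mod n"
    unfolding r by (rule mod_add_left_eq)
  also have "p + j + (n - p) = j + n"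
    using assms by simp
  finally show "(r + n - p) mod n = j mod n"
    by simp
qed

text \<open>In the product \<open>P\<^sub>n\<^sup>j P\<^sub>n\<close>, row \<open>p\<close> of the left factor has its single 1 in column
  \<open>(p + j) mod n\<close>, which selects that row of \<open>P\<^sub>n\<close>.\<close>

lemma fund_circ_power:
  assumes "n \<ge> 1"
  shows "fund_circ n ^\<^sub>m j = circ n (\<lambda>k. if k = j mod n then 1 else 0)"
proof (induction j)
  case 0
  show ?case
    using assms circ_index_eq_iff[of _ n _ 0]
    by (intro eq_matI) (auto simp: fund_circ_def circ_def)
next
  case (Suc j)
  have "circ n (\<lambda>k. if k = j mod n then 1 else 0) * fund_circ n =
      circ n (\<lambda>k. if k = Suc j mod n then (1 :: complex) else 0)" (is "?A * _ = ?B")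
  proof (rule eq_matI)
    fix p q assume "p < dim_row ?B" "q < dim_col ?B"
    then have pq: "p < n" "q < n" by (auto simp: circ_def)
    have r: "(p + j) mod n < n" using assms by simp
    have "(?A * fund_circ n) $$ (p, q) = (\<Sum>r<n.
        (if (r + n - p) mod n = j mod n then 1 else 0) *
        (if (q + n - r) mod n = 1 mod n then 1 else (0 :: complex)))"
      using pq by (simp add: fund_circ_def circ_def scalar_prod_def lessThan_atLeast0)
    also have "\<dots> = (\<Sum>r<n. if r = (p + j) mod n
        then (if q = (r + 1) mod n then 1 else 0) else 0)"
      by (intro sum.cong refl) (use pq in \<open>simp only: lessThan_iff circ_index_eq_iff; simp\<close>)
    also have "\<dots> = (if q = ((p + j) mod n + 1) mod n then 1 else 0)"
      using r by (simp add: sum.delta)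
    also have "\<dots> = (if q = (p + Suc j) mod n then 1 else 0)"
      by (simp add: mod_Suc_eq)
    also have "\<dots> = ?B $$ (p, q)"
      using pq circ_index_eq_iff[of p n q "Suc j"] by (simp add: circ_def)
    finally show "(?A * fund_circ n) $$ (p, q) = ?B $$ (p, q)" .
  qed (auto simp: circ_def fund_circ_def)
  then show ?case by (simp add: Suc.IH)
qed

lemma circ_eq_combination_of_powers:
  assumes "n \<ge> 1"
  shows "(\<Oplus>\<^bsub>cmat_space n\<^esub> j \<in> {..<n}. c j \<cdot>\<^sub>m (fund_circ n ^\<^sub>m j)) = circ n c"
proof -
  have "(\<Oplus>\<^bsub>cmat_space n\<^esub> j \<in> {..<n}. c j \<cdot>\<^sub>m (fund_circ n ^\<^sub>m j)) =
      circ n (\<lambda>k. \<Sum>j<n. c j * (if k = j mod n then 1 else 0))"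
    by (simp only: fund_circ_power[OF assms] finsum_smult_circ[OF finite_lessThan])
  also have "\<dots> = circ n c"
  proof (rule circ_cong)
    fix k assume "k < n"
    have "(\<Sum>j<n. c j * (if k = j mod n then 1 else 0)) = (\<Sum>j<n. if k = j then c j else 0)"
      by (rule sum.cong) auto
    then show "(\<Sum>j<n. c j * (if k = j mod n then 1 else 0)) = c k"
      using \<open>k < n\<close> by simp
  qed
  finally show ?thesis .
qed

text \<open>Linear dependence is a statement about the set \<open>v ` {..<n}\<close> and weights on its elements;
  the injectivity in \<open>lin_indpt_family\<close> lets weights on indices be transported to it.\<close>

lemma lin_indpt_family_weights_zero:
  assumes indpt: "lin_indpt_family n v"
    and carrier: "\<And>i. i < n \<Longrightarrow> v i \<in> carrier_mat n n"
    and zero: "(\<Oplus>\<^bsub>cmat_space n\<^esub> i \<in> {..<n}. w i \<cdot>\<^sub>m v i) = 0\<^sub>m n n"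
    and "i < n"
  shows "w i = 0"
proof (rule ccontr)
  assume "w i \<noteq> 0"
  interpret vectorspace class_ring "cmat_space n" by (rule matrix_vs)
  have inj: "inj_on v {..<n}" using indpt by (simp add: lin_indpt_family_def)
  define a where "a = w \<circ> the_inv_into {..<n} v"
  have a: "a (v j) = w j" if "j < n" for j
    using that inj by (simp add: a_def the_inv_into_f_f)
  have "lincomb a (v ` {..<n}) = (\<Oplus>\<^bsub>cmat_space n\<^esub> j \<in> {..<n}. a (v j) \<cdot>\<^sub>m v j)"
    unfolding lincomb_def module_mat_simps using inj carrier
    by (subst finsum_reindex) (auto simp: module_mat_simps)
  also have "\<dots> = (\<Oplus>\<^bsub>cmat_space n\<^esub> j \<in> {..<n}. w j \<cdot>\<^sub>m v j)"
    using carrier by (intro finsum_cong') (auto simp: a module_mat_simps)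
  finally have "lincomb a (v ` {..<n}) = \<zero>\<^bsub>cmat_space n\<^esub>"
    by (simp add: zero module_mat_simps)
  moreover have "a (v i) \<noteq> 0" using a \<open>i < n\<close> \<open>w i \<noteq> 0\<close> by simp
  ultimately have "lin_dep (v ` {..<n})"
    unfolding lin_dep_def using \<open>i < n\<close>
    by (intro exI[of _ "v ` {..<n}"] exI[of _ a] exI[of _ "v i"]) (auto simp: class_ring_simps)
  then show False using indpt by (simp add: lin_indpt_family_def)
qed

lemma det_nonzero_if_lin_indpt_circ_rows:
  assumes C: "C \<in> carrier_mat n n"
    and v: "\<And>i. i < n \<Longrightarrow> v i = circ n (\<lambda>k. C $$ (i, k))"
    and indpt: "lin_indpt_family n v"
  shows "det C \<noteq> 0"
proof
  assume "det C = 0"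
  then have "det C\<^sup>T = 0" using C by (simp add: det_transpose)
  then obtain w where w: "w \<in> carrier_vec n" "w \<noteq> 0\<^sub>v n" "C\<^sup>T *\<^sub>v w = 0\<^sub>v n"
    using C det_0_iff_vec_prod_zero_field[of "C\<^sup>T" n] by auto
  have wC: "(\<Sum>i<n. w $ i * C $$ (i, k)) = 0" if "k < n" for k
  proof -
    have "(\<Sum>i<n. w $ i * C $$ (i, k)) = (C\<^sup>T *\<^sub>v w) $ k"
      using C w(1) that by (simp add: scalar_prod_def lessThan_atLeast0 mult.commute)
    then show ?thesis using w that by simp
  qed
  interpret abelian_group "cmat_space n" by (rule abelian_group_mat)
  have "(\<Oplus>\<^bsub>cmat_space n\<^esub> i \<in> {..<n}. w $ i \<cdot>\<^sub>m v i) =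
      (\<Oplus>\<^bsub>cmat_space n\<^esub> i \<in> {..<n}. w $ i \<cdot>\<^sub>m circ n (\<lambda>k. C $$ (i, k)))"
    by (intro finsum_cong') (auto simp: v module_mat_simps)
  also have "\<dots> = circ n (\<lambda>_. 0)"
    unfolding finsum_smult_circ[OF finite_lessThan] by (rule circ_cong) (rule wC)
  finally have zero: "(\<Oplus>\<^bsub>cmat_space n\<^esub> i \<in> {..<n}. w $ i \<cdot>\<^sub>m v i) = 0\<^sub>m n n"
    unfolding circ_zero .
  have "w $ i = 0" if "i < n" for i
    by (rule lin_indpt_family_weights_zero[OF indpt _ zero that]) (simp only: v circ_carrier)
  then have "w = 0\<^sub>v n" using w by (intro eq_vecI) auto
  with w show False by simp
qed

lemma mat_inverse_of_det_nonzero: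
  fixes A :: "'a :: field mat"
  assumes A: "A \<in> carrier_mat n n" and "det A \<noteq> 0"
  shows "the (mat_inverse A) * A = 1\<^sub>m n" "the (mat_inverse A) \<in> carrier_mat n n"
proof -
  have "A \<in> Units (ring_mat TYPE('a) n ())"
    using assms by (rule det_non_zero_imp_unit)
  then obtain B where "mat_inverse A = Some B"
    using mat_inverse(1)[OF A, of "()"] by (cases "mat_inverse A") auto
  then show "the (mat_inverse A) * A = 1\<^sub>m n" "the (mat_inverse A) \<in> carrier_mat n n"
    using mat_inverse(2)[OF A] by auto
qed

theorem theorem4p6:
  fixes n :: nat
    and C :: "complex mat"
    and v :: "nat \<Rightarrow> complex mat"
  assumes "n \<ge> 1"
    and "C \<in> carrier_mat n n"
    and "\<And>i. i < n \<Longrightarrow>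
      v i = (\<Oplus>\<^bsub>cmat_space n\<^esub> j \<in> {..<n}. C $$ (i, j) \<cdot>\<^sub>m (fund_circ n ^\<^sub>m j))"
    and "lin_indpt_family n v"
    and "elements_mat (the (mat_inverse C)) \<subseteq> \<int>"
  shows "\<forall>M. is_circulant n M \<and> elements_mat M \<subseteq> \<int> \<longrightarrow> M \<in> int_lattice n v"
proof (intro allI impI)
  fix M :: "complex mat"
  assume M: "is_circulant n M \<and> elements_mat M \<subseteq> \<int>"
  then obtain m where m: "M = circ n m" by (auto simp: is_circulant_def)
  have v: "v i = circ n (\<lambda>k. C $$ (i, k))" if "i < n" for i
    using assms(3)[OF that] circ_eq_combination_of_powers[OF assms(1)] by simp
  define B where "B = the (mat_inverse C)"
  have B: "B * C = 1\<^sub>m n" "B \<in> carrier_mat n n"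
    using mat_inverse_of_det_nonzero[OF assms(2)]
      det_nonzero_if_lin_indpt_circ_rows[OF assms(2) v assms(4)]
    by (simp_all add: B_def)
  have m_int: "m k \<in> \<int>" if "k < n" for k
  proof -
    have "m k = M $$ (0, k)" using that by (simp add: m circ_def)
    then have "m k \<in> elements_mat M" using that by (intro elements_matI[of M n n 0 k]) (auto simp: m)
    then show ?thesis using M by blast
  qed
  have B_int: "B $$ (l, i) \<in> \<int>" if "l < n" "i < n" for l i
    using assms(5) elements_matI[OF B(2) that refl] by (auto simp: B_def)
  have "\<forall>i. \<exists>a :: int. i < n \<longrightarrow> (\<Sum>l<n. m l * B $$ (l, i)) = of_int a"
  proof
    fix i
    have "(\<Sum>l<n. m l * B $$ (l, i)) \<in> \<int>" if "i < n"
      using that m_int B_int by (auto intro!: Ints_sum Ints_mult)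
    then show "\<exists>a :: int. i < n \<longrightarrow> (\<Sum>l<n. m l * B $$ (l, i)) = of_int a"
      by (auto elim!: Ints_cases)
  qed
  then obtain a :: "nat \<Rightarrow> int"
    where a: "\<And>i. i < n \<Longrightarrow> (\<Sum>l<n. m l * B $$ (l, i)) = of_int (a i)"
    by metis
  have aC: "(\<Sum>i<n. of_int (a i) * C $$ (i, k)) = m k" if "k < n" for k
  proof -
    have BC: "(\<Sum>i<n. B $$ (l, i) * C $$ (i, k)) = (if l = k then 1 else 0)" if "l < n" for l
    proof -
      have "(\<Sum>i<n. B $$ (l, i) * C $$ (i, k)) = (B * C) $$ (l, k)"
        using \<open>k < n\<close> that B(2) assms(2) by (simp add: scalar_prod_def lessThan_atLeast0)
      then show ?thesis using \<open>k < n\<close> that by (simp add: B(1))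
    qed
    have "(\<Sum>i<n. of_int (a i) * C $$ (i, k)) = (\<Sum>i<n. \<Sum>l<n. m l * B $$ (l, i) * C $$ (i, k))"
      by (intro sum.cong) (auto simp: a[symmetric] sum_distrib_right)
    also have "\<dots> = (\<Sum>l<n. m l * (\<Sum>i<n. B $$ (l, i) * C $$ (i, k)))"
      by (subst sum.swap) (simp add: sum_distrib_left mult.assoc)
    also have "\<dots> = (\<Sum>l<n. if l = k then m l else 0)"
      by (intro sum.cong) (auto simp: BC)
    also have "\<dots> = m k" using that by simp
    finally show ?thesis .
  qed
  interpret abelian_group "cmat_space n" by (rule abelian_group_mat)
  have "(\<Oplus>\<^bsub>cmat_space n\<^esub> i \<in> {..<n}. of_int (a i) \<cdot>\<^sub>m v i) =
      (\<Oplus>\<^bsub>cmat_space n\<^esub> i \<in> {..<n}. of_int (a i) \<cdot>\<^sub>m circ n (\<lambda>k. C $$ (i, k)))"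
    by (intro finsum_cong') (auto simp: v module_mat_simps)
  also have "\<dots> = M"
    unfolding finsum_smult_circ[OF finite_lessThan] m by (rule circ_cong) (rule aC)
  finally show "M \<in> int_lattice n v"
    unfolding int_lattice_def by (intro range_eqI[where x = a]) (rule sym)
qed

end
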